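(* Assume that the $\mathcal{B}$-free lattice system $(\mathbb{X}_{\mathcal{B}},\mathbb{Z}^d)$ is Erdős, and let $P$ and $Q$ be disjoint finite subsets of $\mathbb{Z}^d$. Let $L(P,Q)=\{t\in\mathbb{Z}^d : t+P\subset V_{\mathcal{B}} \text{ and } t+Q\subset\mathbb{Z}^d\setminus V_{\mathcal{B}}\}$. Then the following properties are equivalent: (1) $L(P,Q)$ has positive natural density. (2) $L(P,Q)\neq\varnothing$. (3) $P$ is admissible for $\mathcal{B}$.
   Context: Let $d\geqslant 1$. Let $\mathcal{B}=\{b_i : i\in\mathbb{N}\}$ be an infinite set of positive integers that is primitive, i.e. $b_i\mid b_j$ implies $i=j$. Put $V_{\mathcal{B}}=\mathbb{Z}^d\setminus\bigcup_{i\in\mathbb{N}}b_i\mathbb{Z}^d$, and let $\mathbb{X}_{\mathcal{B}}=\overline{\mathbb{Z}^d+V_{\mathcal{B}}}$ be the closure of $\{t+V_{\mathcal{B}} : t\in\mathbb{Z}^d\}$ in the power set of $\mathbb{Z}^d$, identified with $\{0,1\}^{\mathbb{Z}^d}$ with the product topology. The dynamical system $(\mathbb{X}_{\mathcal{B}},\mathbb{Z}^d)$ (shift action) is called a $\mathcal{B}$-free lattice system. It is called Erdős when the $b_i$ are pairwise coprime and $\sum_{b\in\mathcal{B}}b^{-d}<\infty$. A set $U\subset\mathbb{Z}^d$ is admissible for $\mathcal{B}$ if, for every $b\in\mathcal{B}$, $U$ misses at least one coset of $b\,\mathbb{Z}^d$ in $\mathbb{Z}^d$. A point set $S\subset\mathbb{R}^d$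 has natural density $\mathrm{dens}(S)=\lim_{r\to\infty}\mathrm{card}(S\cap B_r)/\mathrm{vol}(B_r)$ if this limit exists, where $B_r$ is the closed ball of radius $r$ around $0$; positive natural density means that the limit exists and is positive. *)

theory Defs
  imports "HOL-Analysis.Analysis"
begin

text \<open>
  The lattice \<open>\<int>\<^sup>d\<close> is rendered as \<open>int ^ 'n\<close> with \<open>d = CARD('n)\<close>, so \<open>d \<ge> 1\<close> holds automatically.
\<close>

definition sublattice :: "nat \<Rightarrow> (int ^ 'n) set" where
  "sublattice b = range (\<lambda>x. int b *s x)"

definition V_free :: "nat set \<Rightarrow> (int ^ 'n) set" where
  "V_free B = UNIV - (\<Union>b\<in>B. sublattice b)"

text \<open>
  The standing assumptions on \<open>\<B>\<close>.  An enumeration \<open>b\<^sub>i\<close> with \<open>b\<^sub>i dvd b\<^sub>j \<Longrightarrow> i = j\<close> is injective,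
  so it carries the same information as its range.
\<close>

definition primitive :: "nat set \<Rightarrow> bool" where
  "primitive B \<longleftrightarrow> (\<forall>a\<in>B. \<forall>b\<in>B. a dvd b \<longrightarrow> a = b)"

definition B_free_generators :: "nat set \<Rightarrow> bool" where
  "B_free_generators B \<longleftrightarrow> infinite B \<and> (\<forall>b\<in>B. 0 < b) \<and> primitive B"

text \<open>
  The system \<open>(\<X>\<^sub>\<B>, \<int>\<^sup>d)\<close> being Erdos is by definition a condition on \<open>\<B>\<close> and \<open>d\<close> alone, so the
  orbit closure \<open>\<X>\<^sub>\<B>\<close> does not occur.
\<close>

definition Erdos :: "nat \<Rightarrow> nat set \<Rightarrow> bool" where
  "Erdos d B \<longleftrightarrow> B_free_generators B \<and> pairwise coprime B \<and> (\<lambda>b. 1 / real b ^ d) summable_on B"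

definition admissible :: "nat set \<Rightarrow> (int ^ 'n) set \<Rightarrow> bool" where
  "admissible B U \<longleftrightarrow> (\<forall>b\<in>B. \<exists>c. U \<inter> (+) c ` sublattice b = {})"

definition locator_set :: "nat set \<Rightarrow> (int ^ 'n) set \<Rightarrow> (int ^ 'n) set \<Rightarrow> (int ^ 'n) set" where
  "locator_set B P Q = {t. (+) t ` P \<subseteq> V_free B \<and> (+) t ` Q \<subseteq> UNIV - V_free B}"

definition lattice_embedding :: "int ^ 'n \<Rightarrow> real ^ 'n" where
  "lattice_embedding t = (\<chi> i. real_of_int (t $ i))"

text \<open>
  The finiteness clause rules out the convention \<open>card A = 0\<close> for infinite \<open>A\<close>.
\<close>

definition has_natural_density :: "(real ^ 'n) set \<Rightarrow> real \<Rightarrow> bool" where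
  "has_natural_density S \<delta> \<longleftrightarrow>
     (\<forall>r. finite (S \<inter> cball 0 r)) \<and>
     ((\<lambda>r. real (card (S \<inter> cball 0 r)) / measure lborel (cball (0 :: real ^ 'n) r)) \<longlongrightarrow> \<delta>) at_top"

definition has_positive_natural_density :: "(real ^ 'n) set \<Rightarrow> bool" where
  "has_positive_natural_density S \<longleftrightarrow> (\<exists>\<delta>>0. has_natural_density S \<delta>)"

end

theory Submission
  imports Defs "HOL-Number_Theory.Cong"
begin

text \<open>
  If some \<open>t\<close> lies in \<open>L(P,Q)\<close>, then \<open>P\<close> misses the coset \<open>-t + b\<int>\<^sup>d\<close> for every \<open>b \<in> \<B>\<close>, so \<open>P\<close> is
  admissible; and a set of positive density is nonempty.  The substance is that admissibility of
  \<open>P\<close> forces the density of \<open>L(P,Q)\<close> to exist and to be positive.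

  Existence.  For finite \<open>K \<subseteq> \<B>\<close> the set \<open>L\<^sub>K\<close> of locators with respect to \<open>K\<close> is periodic modulo
  \<open>\<Prod>K\<close>, so it is a finite disjoint union of cosets \<open>a + N\<int>\<^sup>d\<close>.  Counting the points of a coset in a
  ball through the half-open cubes of side \<open>N\<close> attached to them shows that a coset has density
  \<open>N\<^sup>-\<^sup>d\<close> (\<open>density_coset\<close>).  The sets \<open>L(P,Q)\<close> and \<open>L\<^sub>K\<close> differ only at points \<open>t\<close> for which some
  \<open>t + x\<close> with \<open>x \<in> P \<union> Q\<close> is divisible by some \<open>b \<in> \<B> - K\<close>.  A nonzero multiple of \<open>b\<close> in a ball of
  radius \<open>r\<close> requires \<open>b \<le> r\<close>, and in that range the number of multiples of \<open>b\<close> is at most a constant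
  times \<open>vol(B\<^sub>r) / b\<^sup>d\<close>.  As \<open>\<Sum>b\<^sup>-\<^sup>d\<close> converges, the difference has arbitrarily small upper density once
  \<open>K\<close> is large (\<open>frequency_tail_small\<close>), and the limit passes from the \<open>L\<^sub>K\<close> to \<open>L(P,Q)\<close>
  (\<open>tendsto_if_eventually_near_constants\<close>).

  Positivity.  It suffices to bound the densities of the \<open>L\<^sub>K\<close> below independently of \<open>K\<close>.  Give each
  \<open>q \<in> Q\<close> its own generator \<open>b\<^sub>q\<close>, exceeding the absolute values of all coordinates of all \<open>p - q\<close>; then the coset of \<open>q\<close>
  modulo \<open>b\<^sub>q\<close> contains no point of \<open>P\<close>.  For every other \<open>b\<close>, admissibility provides a coset modulo \<open>b\<close>
  free of \<open>P\<close>.  Let \<open>K\<^sub>0\<close> be a finite set containing all \<open>b\<^sub>q\<close>, and \<open>N\<close> its product.  By the Chinese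
  remainder theorem there is a coset modulo \<open>N\<close> all of whose elements \<open>t\<close> satisfy
  \<open>t + q \<in> b\<^sub>q\<int>\<^sup>d\<close> for \<open>q \<in> Q\<close> and \<open>t + p \<notin> b\<int>\<^sup>d\<close> for \<open>p \<in> P\<close>, \<open>b \<in> K\<^sub>0\<close>.  The part of it that violates the
  remaining condition for \<open>p\<close> and \<open>b \<in> K - K\<^sub>0\<close> lies in a coset modulo \<open>N b\<close>, since \<open>b\<close> is coprime to \<open>N\<close>.
  Hence \<open>L\<^sub>K\<close> has density at least \<open>N\<^sup>-\<^sup>d (1 - |P| \<Sum>\<^bsub>b \<notin> K\<^sub>0\<^esub> b\<^sup>-\<^sup>d)\<close>, which is at least \<open>N\<^sup>-\<^sup>d / 2\<close> for a suitable
  choice of \<open>K\<^sub>0\<close> (\<open>density_locator_set_lower_bound\<close>).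
\<close>

section \<open>Relative frequency in balls\<close>

definition window :: "(int ^ 'n) set \<Rightarrow> real \<Rightarrow> (int ^ 'n) set" where
  "window S r = {t \<in> S. norm (lattice_embedding t) \<le> r}"

definition frequency :: "(int ^ 'n) set \<Rightarrow> real \<Rightarrow> real" where
  "frequency S r = real (card (window S r)) / measure lborel (cball (0 :: real ^ 'n) r)"

definition coset :: "nat \<Rightarrow> int ^ 'n \<Rightarrow> (int ^ 'n) set" where
  "coset N a = {t. \<forall>i. int N dvd t $ i - a $ i}"

lemma mem_window: "t \<in> window S r \<longleftrightarrow> t \<in> S \<and> norm (lattice_embedding t) \<le> r"
  by (simp add: window_def)

lemma finite_int_vectors_bounded: "finite {t :: int ^ 'n. \<forall>i. \<bar>t $ i\<bar> \<le> m}"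
proof (rule finite_subset)
  show "{t :: int ^ 'n. \<forall>i. \<bar>t $ i\<bar> \<le> m} \<subseteq> vec_lambda ` (PiE UNIV (\<lambda>_. {-m..m}))"
  proof
    fix t :: "int ^ 'n" assume "t \<in> {t. \<forall>i. \<bar>t $ i\<bar> \<le> m}"
    then have "(\<lambda>i. t $ i) \<in> PiE UNIV (\<lambda>_. {-m..m})" by (auto simp: abs_le_iff) (smt (verit))
    then show "t \<in> vec_lambda ` (PiE UNIV (\<lambda>_. {-m..m}))"
      by (metis (no_types, lifting) image_eqI vec_nth_inverse)
  qed
  show "finite (vec_lambda ` (PiE (UNIV :: 'n set) (\<lambda>_. {-m..m})))"
    by (intro finite_imageI finite_PiE) auto
qed

lemma lattice_embedding_nth [simp]: "lattice_embedding t $ i = real_of_int (t $ i)"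
  by (simp add: lattice_embedding_def)

lemma inj_lattice_embedding: "inj lattice_embedding"
  by (auto simp: inj_def vec_eq_iff)

lemma lattice_embedding_add: "lattice_embedding (s + t) = lattice_embedding s + lattice_embedding t"
  by (simp add: vec_eq_iff)

lemma coordinate_le_norm: "real_of_int \<bar>t $ i\<bar> \<le> norm (lattice_embedding t)"
  using component_le_norm_cart[of "lattice_embedding t" i] by simp

lemma finite_window [simp]: "finite (window S r)"
proof (rule finite_subset)
  show "window S r \<subseteq> {t. \<forall>i. \<bar>t $ i\<bar> \<le> \<lceil>r\<rceil>}"
  proof (clarsimp simp: window_def)
    fix t :: "int ^ 'n" and i assume "norm (lattice_embedding t) \<le> r"
    then have "real_of_int \<bar>t $ i\<bar> \<le> r" using coordinate_le_norm[of t i] by linarith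
    then show "\<bar>t $ i\<bar> \<le> \<lceil>r\<rceil>" by linarith
  qed
qed (rule finite_int_vectors_bounded)

lemma window_subset: "window S r \<subseteq> S"
  by (auto simp: window_def)

lemma window_mono: "S \<subseteq> T \<Longrightarrow> window S r \<subseteq> window T r"
  by (auto simp: window_def)

lemma image_Int_cball_eq_window: "lattice_embedding ` S \<inter> cball 0 r = lattice_embedding ` window S r"
  by (auto simp: window_def)

text \<open>
  The finiteness clause of natural density is automatic for sets of lattice points, so density is
  just a limit of frequencies, and the rest of the argument can take place in \<open>int ^ 'n\<close>.
\<close>

lemma has_natural_density_iff_frequency:
  "has_natural_density (lattice_embedding ` S) \<delta> \<longleftrightarrow> (frequency S \<longlongrightarrow> \<delta>) at_top"
proof -
  have "card (lattice_embedding ` window S r) = card (window S r)" for r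
    by (meson card_image inj_lattice_embedding inj_on_subset subset_UNIV)
  then show ?thesis
    by (simp add: has_natural_density_def image_Int_cball_eq_window frequency_def[abs_def])
qed

lemma frequency_mono: "S \<subseteq> T \<Longrightarrow> frequency S r \<le> frequency T r"
  by (simp add: frequency_def divide_right_mono card_mono window_mono)

lemma frequency_Un_le: "frequency (S \<union> T) r \<le> frequency S r + frequency T r"
proof -
  have "window (S \<union> T) r = window S r \<union> window T r" by (auto simp: window_def)
  then have "real (card (window (S \<union> T) r)) \<le> real (card (window S r)) + real (card (window T r))"
    by (metis card_Un_le of_nat_add of_nat_le_iff)
  then show ?thesis by (simp add: frequency_def divide_right_mono flip: add_divide_distrib)
qed

lemma frequency_UN_le:
  "finite I \<Longrightarrow> frequency (\<Union>i\<in>I. S i) r \<le> (\<Sum>i\<in>I. frequency (S i) r)"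
proof (induction I rule: finite_induct)
  case empty
  then show ?case by (simp add: frequency_def window_def)
next
  case (insert x F)
  then show ?case using frequency_Un_le[of "S x" "\<Union>i\<in>F. S i" r] by simp
qed

lemma frequency_disjoint_UN:
  assumes "finite I" "disjoint_family_on S I"
  shows "frequency (\<Union>i\<in>I. S i) r = (\<Sum>i\<in>I. frequency (S i) r)"
proof -
  have "window (\<Union>i\<in>I. S i) r = (\<Union>i\<in>I. window (S i) r)" by (auto simp: window_def)
  moreover have "card (\<Union>i\<in>I. window (S i) r) = (\<Sum>i\<in>I. card (window (S i) r))"
    using assms     by (intro card_UN_disjoint) (simp, simp, use assms(2) window_subset in \<open>fastforce simp: disjoint_family_on_def\<close>)
  ultimately show ?thesis
    by (simp add: frequency_def sum_divide_distrib)
qed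

section \<open>Densities of cosets and of periodic sets\<close>

text \<open>
  The cubes are half-open so that those attached to the points of a coset modulo \<open>N\<close> tile space
  without overlap.
\<close>

definition cell :: "nat \<Rightarrow> int ^ 'n \<Rightarrow> (real ^ 'n) set" where
  "cell N t = {x. \<forall>i. real_of_int (t $ i) \<le> x $ i \<and> x $ i < real_of_int (t $ i) + real N}"

lemma sets_cell: "cell N t \<in> sets borel"
proof -
  have "cell N t = (\<Inter>i. {x. real_of_int (t $ i) \<le> x $ i} \<inter> {x. x $ i < real_of_int (t $ i) + real N})"
    by (auto simp: cell_def)
  also have "\<dots> \<in> sets borel"
    by (intro sets.countable_INT'' sets.Int borel_closed borel_open closed_halfspace_component_ge_cart
        open_halfspace_component_lt_cart) auto
  finally show ?thesis .
qed

lemma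
  fixes t :: "int ^ 'n"
  shows fmeasurable_cell: "cell N t \<in> fmeasurable lborel"
    and measure_cell: "measure lborel (cell N t) = real N ^ CARD('n)"
proof -
  define a b where "a = lattice_embedding t" and "b = a + (\<chi> i. real N)"
  have sub: "box a b \<subseteq> cell N t" "cell N t \<subseteq> cbox a b"
    by (auto simp: cell_def a_def b_def mem_box_cart less_imp_le)
  show fin: "cell N t \<in> fmeasurable lborel"
    by (rule fmeasurableI2[OF _ sub(2)]) (auto simp: sets_cell)
  have ne: "cbox a b \<noteq> {}" by (auto simp: a_def b_def interval_ne_empty_cart)
  have c: "measure lborel (cbox a b) = real N ^ CARD('n)"
    unfolding content_cbox_cart[OF ne] by (simp add: b_def)
  have "measure lborel (cell N t) \<le> measure lborel (cbox a b)"
    by (rule measure_mono_fmeasurable[OF sub(2)]) (auto simp: sets_cell)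
  moreover have "measure lborel (box a b) \<le> measure lborel (cell N t)"
    by (rule measure_mono_fmeasurable[OF sub(1) _ fin]) simp
  moreover have "measure lborel (box a b) = measure lborel (cbox a b)"
    by (simp add: measure_lborel_box_eq measure_lborel_cbox_eq)
  ultimately show "measure lborel (cell N t) = real N ^ CARD('n)" using c by linarith
qed

lemma dist_cell_corner:
  fixes t :: "int ^ 'n"
  assumes "x \<in> cell N t"
  shows "norm (x - lattice_embedding t) \<le> real N * real CARD('n)"
proof -
  have "norm (x - lattice_embedding t) \<le> (\<Sum>i\<in>UNIV. \<bar>(x - lattice_embedding t) $ i\<bar>)"
    by (rule norm_le_l1_cart)
  also have "\<dots> \<le> (\<Sum>i\<in>(UNIV :: 'n set). real N)"
    using assms by (intro sum_mono) (auto simp: cell_def abs_le_iff less_imp_le algebra_simps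
        add_increasing2)
  finally show ?thesis by (simp add: mult.commute)
qed

lemma disjoint_family_cells:
  fixes a :: "int ^ 'n"
  shows "disjoint_family_on (cell N) (coset N a)"
proof -
  have "s = t" if st: "s \<in> coset N a" "t \<in> coset N a" and x: "x \<in> cell N s" "x \<in> cell N t"
    for s t :: "int ^ 'n" and x
  proof -
    have "s $ i = t $ i" for i
    proof -
      have "int N dvd (s $ i - a $ i) - (t $ i - a $ i)"
        using st unfolding coset_def by (blast intro: dvd_diff)
      then have "int N dvd s $ i - t $ i" by simp
      moreover have "real_of_int (s $ i) < real_of_int (t $ i) + real N"
          "real_of_int (t $ i) < real_of_int (s $ i) + real N"
        using x unfolding cell_def by (smt (verit) mem_Collect_eq)+
      then have "\<bar>s $ i - t $ i\<bar> < int N" by linarith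
      ultimately show ?thesis using dvd_imp_le_int[of "s $ i - t $ i" "int N"] by fastforce
    qed
    then show ?thesis by (simp add: vec_eq_iff)
  qed
  then show ?thesis unfolding disjoint_family_on_def by blast
qed

lemma cells_cover:
  fixes a :: "int ^ 'n"
  assumes "N > 0"
  shows "\<exists>t\<in>coset N a. x \<in> cell N t"
proof -
  define t where "t = (\<chi> i. a $ i + int N * \<lfloor>(x $ i - real_of_int (a $ i)) / real N\<rfloor>)"
  have "t \<in> coset N a" by (simp add: t_def coset_def)
  moreover have "x \<in> cell N t"
  proof -
    have "real_of_int (t $ i) \<le> x $ i \<and> x $ i < real_of_int (t $ i) + real N" for i
    proof -
      let ?y = "(x $ i - real_of_int (a $ i)) / real N"
      have "real N * real_of_int \<lfloor>?y\<rfloor> \<le> real N * ?y" "real N * ?y < real N * (real_of_int \<lfloor>?y\<rfloor> + 1)"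
        using assms by (intro mult_left_mono mult_strict_left_mono; linarith)+
      moreover have "real N * ?y = x $ i - real_of_int (a $ i)" using assms by simp
      ultimately show ?thesis by (simp add: t_def algebra_simps)
    qed
    then show ?thesis by (simp add: cell_def)
  qed
  ultimately show ?thesis by blast
qed

lemma fmeasurable_cball: "cball x r \<in> fmeasurable lborel"
  by (simp add: fmeasurable_def emeasure_lborel_cball_finite[unfolded infinity_ennreal_def])

text \<open>
  The cubes attached to the coset points in \<open>B\<^sub>r\<close> are disjoint and have volume \<open>N\<^sup>d\<close> each.  Every cube
  stays within \<open>N d\<close> of its corner, so their union is contained in \<open>B\<^bsub>r + Nd\<^esub>\<close>, and it contains
  \<open>B\<^bsub>r - Nd\<^esub>\<close> because the cubes of all coset points cover space.
  The error is explicit in \<open>N\<close>, so the upper bound can be summed over varying moduli.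
\<close>

lemma card_coset_window:
  fixes a :: "int ^ 'n"
  assumes N: "N > 0"
  defines "V \<equiv> \<lambda>r. measure lborel (cball (0 :: real ^ 'n) r)"
  shows "V (r - real N * real CARD('n)) \<le> real (card (window (coset N a) r)) * real N ^ CARD('n)"
    and "real (card (window (coset N a) r)) * real N ^ CARD('n) \<le> V (r + real N * real CARD('n))"
proof -
  define U where "U = (\<Union>t\<in>window (coset N a) r. cell N t)"
  have "measure lborel U = (\<Sum>t\<in>window (coset N a) r. measure lborel (cell N t))"
    unfolding U_def
    using disjoint_family_on_mono[OF _ disjoint_family_cells[of N a], of "window (coset N a) r"]
      window_subset[of "coset N a" r]
    by (intro measure_finite_Union) (auto simp: sets_cell fmeasurableD2[OF fmeasurable_cell, unfolded infinity_ennreal_def])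
  then have U: "measure lborel U = real (card (window (coset N a) r)) * real N ^ CARD('n)"
    by (simp add: measure_cell)
  have upper: "U \<subseteq> cball 0 (r + real N * real CARD('n))"
  proof
    fix x assume "x \<in> U"
    then obtain t where t: "x \<in> cell N t" "norm (lattice_embedding t) \<le> r"
      by (auto simp: U_def window_def)
    then show "x \<in> cball 0 (r + real N * real CARD('n))"
      using dist_cell_corner[OF t(1)] norm_triangle_ineq2[of x "lattice_embedding t"] by simp
  qed
  have lower: "cball 0 (r - real N * real CARD('n)) \<subseteq> U"
  proof
    fix x :: "real ^ 'n" assume x: "x \<in> cball 0 (r - real N * real CARD('n))"
    obtain t where t: "t \<in> coset N a" "x \<in> cell N t" using cells_cover[OF N] by blast
    have "norm (lattice_embedding t) \<le> r"
      using x dist_cell_corner[OF t(2)] norm_triangle_ineq3[of x "lattice_embedding t"] by simp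
    with t show "x \<in> U" by (auto simp: U_def window_def)
  qed
  have sets_U: "U \<in> sets lborel" unfolding U_def
    by (intro sets.finite_UN) (auto simp: sets_cell)
  show "real (card (window (coset N a) r)) * real N ^ CARD('n) \<le> V (r + real N * real CARD('n))"
    unfolding U[symmetric] V_def
    by (rule measure_mono_fmeasurable[OF upper sets_U]) (auto simp: fmeasurable_cball)
  have "U \<in> fmeasurable lborel"
    by (rule fmeasurableI2[OF _ upper sets_U]) (auto simp: fmeasurable_cball)
  then show "V (r - real N * real CARD('n)) \<le> real (card (window (coset N a) r)) * real N ^ CARD('n)"
    unfolding U[symmetric] V_def
    by (intro measure_mono_fmeasurable[OF lower]) auto
qed

lemma measure_cball_scaled:
  fixes c :: real
  assumes "c \<ge> 0" "r \<ge> 0"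
  shows "measure lborel (cball (0 :: real ^ 'n) (c * r)) = c ^ CARD('n) * measure lborel (cball (0 :: real ^ 'n) r)"
  using assms by (simp add: content_cball power_mult_distrib)

lemma measure_cball_pos: "r > 0 \<Longrightarrow> 0 < measure lborel (cball (0 :: real ^ 'n) r)"
  by (simp add: content_cball)

lemma density_coset:
  fixes a :: "int ^ 'n"
  assumes N: "N > 0"
  shows "(frequency (coset N a) \<longlongrightarrow> 1 / real N ^ CARD('n)) at_top"
proof (rule real_tendsto_sandwich)
  let ?D = "real N * real CARD('n)"
  let ?V = "\<lambda>r. measure lborel (cball (0 :: real ^ 'n) r)"
  have V: "?V s / ?V r = (s / r) ^ CARD('n)" if "r > 0" "s \<ge> 0" for r s
    using that measure_cball_scaled[where 'n='n, of "s / r" r] measure_cball_pos[of r, where 'n='n]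
    by (simp add: field_simps)
  have pos: "real N ^ CARD('n) > 0" using N by simp
  show "\<forall>\<^sub>F r in at_top. (1 - ?D / r) ^ CARD('n) / real N ^ CARD('n) \<le> frequency (coset N a) r"
    using eventually_gt_at_top[of ?D] eventually_gt_at_top[of 0]
  proof eventually_elim
    case (elim r)
    have "(1 - ?D / r) ^ CARD('n) / real N ^ CARD('n) = ?V (r - ?D) / ?V r / real N ^ CARD('n)"
      using elim by (subst V) (auto simp: field_simps)
    also have "\<dots> \<le> frequency (coset N a) r"
      using card_coset_window(1)[OF N, of r a] pos measure_cball_pos[of r, where 'n='n] elim
      by (simp add: frequency_def field_simps)
    finally show ?case .
  qed
  show "\<forall>\<^sub>F r in at_top. frequency (coset N a) r \<le> (1 + ?D / r) ^ CARD('n) / real N ^ CARD('n)"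
    using eventually_gt_at_top[of 0]
  proof eventually_elim
    case (elim r)
    have "(1 + ?D / r) ^ CARD('n) / real N ^ CARD('n) = ?V (r + ?D) / ?V r / real N ^ CARD('n)"
      using elim by (subst V) (auto simp: field_simps)
    moreover have "frequency (coset N a) r \<le> \<dots>"
      using card_coset_window(2)[OF N, of a r] pos measure_cball_pos[of r, where 'n='n] elim
      by (simp add: frequency_def field_simps)
    ultimately show ?case by simp
  qed
  have lim: "((\<lambda>r. ?D / r) \<longlongrightarrow> 0) at_top"
    by (intro tendsto_divide_0[OF tendsto_const] filterlim_at_top_imp_at_infinity filterlim_ident)
  have "((\<lambda>r. (1 - ?D / r) ^ CARD('n) / real N ^ CARD('n)) \<longlongrightarrow> (1 - 0) ^ CARD('n) / real N ^ CARD('n)) at_top"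
    using N by (intro tendsto_intros lim) auto
  then show "((\<lambda>r. (1 - ?D / r) ^ CARD('n) / real N ^ CARD('n)) \<longlongrightarrow> 1 / real N ^ CARD('n)) at_top" by simp
  have "((\<lambda>r. (1 + ?D / r) ^ CARD('n) / real N ^ CARD('n)) \<longlongrightarrow> (1 + 0) ^ CARD('n) / real N ^ CARD('n)) at_top"
    using N by (intro tendsto_intros lim) auto
  then show "((\<lambda>r. (1 + ?D / r) ^ CARD('n) / real N ^ CARD('n)) \<longlongrightarrow> 1 / real N ^ CARD('n)) at_top" by simp
qed

text \<open>
  A set invariant modulo \<open>N\<close> is the disjoint union of the cosets of its finitely many elements in
  the box \<open>{0..<N}\<^sup>d\<close>.
\<close>

lemma density_periodic:
  fixes S :: "(int ^ 'n) set"
  assumes N: "N > 0" and periodic: "\<And>s t. s \<in> S \<Longrightarrow> t \<in> coset N s \<Longrightarrow> t \<in> S"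
  shows "\<exists>\<delta>. (frequency S \<longlongrightarrow> \<delta>) at_top"
proof -
  define R where "R = {a \<in> S. \<forall>i. 0 \<le> a $ i \<and> a $ i < int N}"
  have "finite R"
    by (rule finite_subset[OF _ finite_int_vectors_bounded[of "int N"]]) (auto simp: R_def less_imp_le)
  have "S = (\<Union>a\<in>R. coset N a)"
  proof (intro equalityI subsetI)
    fix s assume s: "s \<in> S"
    define a where "a = (\<chi> i. s $ i mod int N)"
    have "a \<in> coset N s" by (simp add: a_def coset_def mod_eq_dvd_iff[symmetric])
    then have "a \<in> R" using periodic[OF s] N by (simp add: R_def a_def)
    moreover have "s \<in> coset N a" by (simp add: a_def coset_def mod_eq_dvd_iff[symmetric])
    ultimately show "s \<in> (\<Union>a\<in>R. coset N a)" by blast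
  next
    fix s assume "s \<in> (\<Union>a\<in>R. coset N a)"
    then show "s \<in> S" using periodic by (auto simp: R_def)
  qed
  moreover have "disjoint_family_on (coset N) R"
  proof -
    have "a = b" if ab: "a \<in> R" "b \<in> R" and x: "x \<in> coset N a" "x \<in> coset N b" for a b x
    proof -
      have "a $ i = b $ i" for i
      proof -
        have "int N dvd (x $ i - b $ i) - (x $ i - a $ i)"
          using x unfolding coset_def by (blast intro: dvd_diff)
        then have "a $ i mod int N = b $ i mod int N" by (simp add: mod_eq_dvd_iff)
        then show ?thesis using ab by (simp add: R_def)
      qed
      then show ?thesis by (simp add: vec_eq_iff)
    qed
    then show ?thesis unfolding disjoint_family_on_def by blast
  qed
  ultimately have "frequency S = (\<lambda>r. \<Sum>a\<in>R. frequency (coset N a) r)"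
    using frequency_disjoint_UN[OF \<open>finite R\<close>, of "coset N"] by auto
  moreover have "((\<lambda>r. \<Sum>a\<in>R. frequency (coset N a) r) \<longlongrightarrow> (\<Sum>a\<in>R. 1 / real N ^ CARD('n))) at_top"
    by (intro tendsto_sum density_coset[OF N])
  ultimately show ?thesis by metis
qed

section \<open>Multiples of late generators are rare\<close>

lemma mem_sublattice: "t \<in> sublattice b \<longleftrightarrow> (\<forall>i. int b dvd t $ i)"
proof
  assume "\<forall>i. int b dvd t $ i"
  then have "t = int b *s (\<chi> i. t $ i div int b)" by (simp add: vec_eq_iff)
  then show "t \<in> sublattice b" unfolding sublattice_def by blast
qed (auto simp: sublattice_def)

lemma image_add_sublattice: "(+) c ` sublattice b = coset b c"
proof (intro equalityI subsetI)
  fix t assume "t \<in> coset b c"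
  then have "t - c \<in> sublattice b" by (simp add: coset_def mem_sublattice)
  then show "t \<in> (+) c ` sublattice b" by (rule rev_image_eqI) simp
qed (auto simp: coset_def mem_sublattice)

lemma summable_on_small_tail:
  fixes f :: "'a \<Rightarrow> real"
  assumes "f summable_on A" "\<epsilon> > 0"
  obtains K where "finite K" "K \<subseteq> A"
    "\<And>F. finite F \<Longrightarrow> F \<subseteq> A - K \<Longrightarrow> sum f F < \<epsilon>"
proof -
  obtain s where "(sum f \<longlongrightarrow> s) (finite_subsets_at_top A)"
    using assms(1) unfolding summable_on_def has_sum_def by blast
  then have "\<forall>\<^sub>F F in finite_subsets_at_top A. dist (sum f F) s < \<epsilon> / 2"
    using assms(2) by (intro tendstoD) auto
  then obtain K where "finite K \<and> K \<subseteq> A \<and>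
      (\<forall>Y. finite Y \<and> K \<subseteq> Y \<and> Y \<subseteq> A \<longrightarrow> dist (sum f Y) s < \<epsilon> / 2)"
    unfolding eventually_finite_subsets_at_top ..
  then have K: "finite K" "K \<subseteq> A"
      "\<And>Y. finite Y \<Longrightarrow> K \<subseteq> Y \<Longrightarrow> Y \<subseteq> A \<Longrightarrow> dist (sum f Y) s < \<epsilon> / 2"
    by simp_all
  have "sum f F < \<epsilon>" if F: "finite F" "F \<subseteq> A - K" for F
  proof -
    have "sum f (K \<union> F) = sum f K + sum f F"
      using F K(1) by (intro sum.union_disjoint) auto
    moreover have "dist (sum f (K \<union> F)) s < \<epsilon> / 2" using F K by (intro K(3)) auto
    moreover have "dist (sum f K) s < \<epsilon> / 2" using K by (intro K(3)) auto
    ultimately show ?thesis unfolding dist_real_def by linarith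
  qed
  with K(1,2) show ?thesis using that by blast
qed

text \<open>
  After translation by \<open>x\<close>, the points to be counted are multiples of some \<open>b \<in> M\<close> in the ball of
  radius \<open>2r\<close>.  The origin is a multiple of all of them but counts once, which accounts for the first
  summand.  Any other such point forces \<open>b \<le> 2r\<close>, and then the bound \<open>vol(B\<^bsub>2r + bd\<^esub>) / b\<^sup>d\<close> for the number
  of multiples of \<open>b\<close> is at most \<open>(2 + 2d)\<^sup>d vol(B\<^sub>r) / b\<^sup>d\<close>.  Without the restriction on \<open>b\<close> the error in
  the number of multiples of \<open>b\<close> could not be summed over infinitely many \<open>b\<close>.
\<close>

lemma frequency_multiples_le:
  fixes x :: "int ^ 'n" and M :: "nat set"
  assumes pos: "\<forall>b\<in>M. 0 < b"
    and small: "\<And>F. finite F \<Longrightarrow> F \<subseteq> M \<Longrightarrow> (\<Sum>b\<in>F. 1 / real b ^ CARD('n)) \<le> \<eta>"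
    and r: "0 < r" "norm (lattice_embedding x) \<le> r"
  shows "frequency {t. \<exists>b\<in>M. t + x \<in> sublattice b} r
           \<le> 1 / measure lborel (cball (0 :: real ^ 'n) r) + (2 + 2 * real CARD('n)) ^ CARD('n) * \<eta>"
proof -
  let ?d = "CARD('n)"
  let ?V = "\<lambda>r. measure lborel (cball (0 :: real ^ 'n) r)"
  let ?C = "(2 + 2 * real ?d) ^ ?d"
  define W where "W = window {t. \<exists>b\<in>M. t + x \<in> sublattice b} r"
  define F where "F = {b \<in> M. real b \<le> 2 * r}"
  have "F \<subseteq> {..nat \<lfloor>2 * r\<rfloor>}" by (auto simp: F_def le_nat_floor)
  then have "finite F" using finite_subset by blast
  have "(\<lambda>t. t + x) ` W \<subseteq> insert 0 (\<Union>b\<in>F. window (coset b 0) (2 * r))"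
  proof clarify
    fix t assume t: "t \<in> W" and nz: "t + x \<notin> (\<Union>b\<in>F. window (coset b 0) (2 * r))"
    let ?u = "t + x"
    obtain b where b: "b \<in> M" "?u \<in> sublattice b" and "norm (lattice_embedding t) \<le> r"
      using t by (auto simp: W_def mem_window)
    then have u: "norm (lattice_embedding ?u) \<le> 2 * r"
      using r norm_triangle_ineq[of "lattice_embedding t" "lattice_embedding x"]
      by (simp add: lattice_embedding_add)
    have "?u \<in> coset b 0" using b by (simp add: coset_def mem_sublattice)
    with nz b u have big: "real b > 2 * r"
      by (metis (mono_tags, lifting) F_def UN_I mem_Collect_eq mem_window not_le)
    have "?u $ i = 0" for i
    proof (rule ccontr)
      assume "?u $ i \<noteq> 0"
      then have "int b \<le> \<bar>?u $ i\<bar>"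
        using b(2) dvd_imp_le_int unfolding mem_sublattice by force
      then show False using big u coordinate_le_norm[of ?u i] by linarith
    qed
    then show "t + x = 0" by (simp add: vec_eq_iff)
  qed
  then have "card ((\<lambda>t. t + x) ` W) \<le> card (insert 0 (\<Union>b\<in>F. window (coset b (0 :: int ^ 'n)) (2 * r)))"
    using \<open>finite F\<close> by (intro card_mono) auto
  also have "\<dots> \<le> 1 + card (\<Union>b\<in>F. window (coset b (0 :: int ^ 'n)) (2 * r))"
    by (simp add: card_insert_le_m1 card_insert_if \<open>finite F\<close>)
  also have "\<dots> \<le> 1 + (\<Sum>b\<in>F. card (window (coset b (0 :: int ^ 'n)) (2 * r)))"
    using card_UN_le[OF \<open>finite F\<close>, of "\<lambda>b. window (coset b (0 :: int ^ 'n)) (2 * r)"] by simp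
  finally have "card W \<le> 1 + (\<Sum>b\<in>F. card (window (coset b (0 :: int ^ 'n)) (2 * r)))"
    by (simp add: card_image inj_on_def)
  then have "real (card W) \<le> 1 + (\<Sum>b\<in>F. real (card (window (coset b (0 :: int ^ 'n)) (2 * r))))"
    by (metis of_nat_1 of_nat_add of_nat_le_iff of_nat_sum)
  also have "\<dots> \<le> 1 + (\<Sum>b\<in>F. ?C * ?V r * (1 / real b ^ ?d))"
  proof (intro add_left_mono sum_mono)
    fix b assume "b \<in> F"
    then have b: "0 < b" "real b \<le> 2 * r" using pos by (auto simp: F_def)
    have "real (card (window (coset b (0 :: int ^ 'n)) (2 * r))) * real b ^ ?d \<le> ?V (2 * r + real b * real ?d)"
      by (rule card_coset_window(2)[OF b(1)])
    also have "\<dots> \<le> ?V ((2 + 2 * real ?d) * r)"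
    proof (rule measure_mono_fmeasurable)
      have "real b * real ?d \<le> 2 * r * real ?d" using b by (intro mult_right_mono) auto
      then show "cball (0 :: real ^ 'n) (2 * r + real b * real ?d) \<subseteq> cball 0 ((2 + 2 * real ?d) * r)"
        by (intro subset_cball) (simp add: algebra_simps)
    qed (auto simp: fmeasurable_cball)
    also have "\<dots> = ?C * ?V r" using r by (intro measure_cball_scaled) auto
    finally show "real (card (window (coset b (0 :: int ^ 'n)) (2 * r))) \<le> ?C * ?V r * (1 / real b ^ ?d)"
      using b by (simp add: field_simps)
  qed
  also have "\<dots> = 1 + ?C * ?V r * (\<Sum>b\<in>F. 1 / real b ^ ?d)"
    by (simp only: sum_distrib_left)
  also have "\<dots> \<le> 1 + ?C * ?V r * \<eta>"
    using \<open>finite F\<close> by (intro add_left_mono mult_left_mono small) (auto simp: F_def)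
  finally have "real (card W) / ?V r \<le> (1 + ?C * ?V r * \<eta>) / ?V r"
    by (intro divide_right_mono) auto
  also have "\<dots> = 1 / ?V r + ?C * \<eta>"
    using measure_cball_pos[OF r(1), where 'n='n] by (simp add: add_divide_distrib)
  finally show ?thesis by (simp add: frequency_def W_def)
qed

lemma frequency_tail_small:
  fixes X :: "(int ^ 'n) set" and B :: "nat set"
  assumes pos: "\<forall>b\<in>B. 0 < b" and summable: "(\<lambda>b. 1 / real b ^ CARD('n)) summable_on B"
    and X: "finite X" and \<epsilon>: "\<epsilon> > 0"
  obtains K where "finite K" "K \<subseteq> B"
    "\<forall>\<^sub>F r in at_top. frequency {t. \<exists>x\<in>X. \<exists>b\<in>B - K. t + x \<in> sublattice b} r \<le> \<epsilon>"
proof -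
  let ?d = "CARD('n)"
  let ?V = "\<lambda>r. measure lborel (cball (0 :: real ^ 'n) r)"
  let ?C = "(2 + 2 * real ?d) ^ ?d"
  define m where "m = real (card X)"
  \<comment> \<open>The summand \<open>1\<close> in the denominator keeps it nonzero when \<open>X\<close> is empty.\<close>
  define \<eta> where "\<eta> = \<epsilon> / (2 * (m * ?C + 1))"
  have "m * ?C + 1 > 0" by (simp add: m_def add_nonneg_pos)
  then have "\<eta> > 0" and "m * (?C * \<eta>) \<le> \<epsilon> / 2"
    using \<epsilon> by (auto simp: \<eta>_def field_simps)
  from summable_on_small_tail[OF summable \<open>\<eta> > 0\<close>] obtain K
    where K: "finite K" "K \<subseteq> B"
      and tail: "\<And>F. finite F \<Longrightarrow> F \<subseteq> B - K \<Longrightarrow> (\<Sum>b\<in>F. 1 / real b ^ ?d) < \<eta>" by blast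
  have V1: "?V 1 > 0" by (rule measure_cball_pos) simp
  have "\<forall>\<^sub>F r in at_top. frequency {t. \<exists>x\<in>X. \<exists>b\<in>B - K. t + x \<in> sublattice b} r \<le> \<epsilon>"
    \<comment> \<open>The second threshold makes the contribution of the origins, \<open>m / vol(B\<^sub>r)\<close>, at most \<open>\<epsilon> / 2\<close>;
      it suffices that \<open>vol(B\<^sub>r)\<close> grows at least linearly beyond \<open>r = 1\<close>.\<close>
    using eventually_ge_at_top[of 1] eventually_ge_at_top[of "2 * m / (?V 1 * \<epsilon>)"]
      eventually_ge_at_top[of "\<Sum>x\<in>X. norm (lattice_embedding x)"]
  proof eventually_elim
    case (elim r)
    have "{t. \<exists>x\<in>X. \<exists>b\<in>B - K. t + x \<in> sublattice b} = (\<Union>x\<in>X. {t. \<exists>b\<in>B - K. t + x \<in> sublattice b})"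
      by auto
    then have "frequency {t. \<exists>x\<in>X. \<exists>b\<in>B - K. t + x \<in> sublattice b} r
        \<le> (\<Sum>x\<in>X. frequency {t. \<exists>b\<in>B - K. t + x \<in> sublattice b} r)"
      using frequency_UN_le[OF X] by simp
    also have "\<dots> \<le> (\<Sum>x\<in>X. 1 / ?V r + ?C * \<eta>)"
    proof (intro sum_mono frequency_multiples_le)
      fix x assume "x \<in> X"
      then have "norm (lattice_embedding x) \<le> (\<Sum>x\<in>X. norm (lattice_embedding x))"
        using X by (intro member_le_sum) auto
      then show "norm (lattice_embedding x) \<le> r" using elim by linarith
    qed (use pos tail elim in \<open>auto intro: less_imp_le\<close>)
    also have "\<dots> = m / ?V r + m * (?C * \<eta>)" by (simp add: m_def algebra_simps)
    also have "m / ?V r \<le> \<epsilon> / 2"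
    proof -
      have "r \<le> r ^ ?d" using elim by (intro self_le_power) auto
      then have "r * ?V 1 \<le> ?V r"
        using measure_cball_scaled[of r 1, where 'n='n] V1 elim by simp
      moreover have "2 * m \<le> r * ?V 1 * \<epsilon>" using elim(2) V1 \<epsilon> by (simp add: field_simps)
      ultimately have "2 * m \<le> ?V r * \<epsilon>"
        using \<epsilon> by (meson less_imp_le mult_right_mono order_trans)
      then show ?thesis using measure_cball_pos[of r, where 'n='n] elim by (simp add: field_simps)
    qed
    finally show ?case using \<open>m * (?C * \<eta>) \<le> \<epsilon> / 2\<close> by linarith
  qed
  with K show ?thesis using that by blast
qed

section \<open>Limits of functions that are nearly constant\<close>

text \<open>
  The limit is the supremum of the eventual lower bounds of \<open>f\<close>: if \<open>f\<close> is eventually within \<open>\<epsilon>\<close> of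
  \<open>\<delta>\<close>, then so is this supremum, so it does not matter that the constants \<open>\<delta>\<close> vary with \<open>\<epsilon>\<close>.
\<close>

lemma tendsto_if_eventually_near_constants:
  fixes f :: "'a \<Rightarrow> real"
  assumes F: "F \<noteq> bot"
    and near: "\<And>\<epsilon>. \<epsilon> > 0 \<Longrightarrow> \<exists>\<delta>\<ge>c. \<forall>\<^sub>F x in F. \<bar>f x - \<delta>\<bar> \<le> \<epsilon>"
  shows "\<exists>\<delta>\<ge>c. (f \<longlongrightarrow> \<delta>) F"
proof -
  define A where "A = {y. \<forall>\<^sub>F x in F. y \<le> f x}"
  have bound: "y \<le> \<delta> + \<epsilon>" if "y \<in> A" "\<forall>\<^sub>F x in F. \<bar>f x - \<delta>\<bar> \<le> \<epsilon>" for y \<delta> \<epsilon>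
  proof -
    have "\<forall>\<^sub>F x in F. y \<le> \<delta> + \<epsilon>"
      using that unfolding A_def mem_Collect_eq by eventually_elim linarith
    then show ?thesis using F by (simp add: eventually_const_iff)
  qed
  have mem: "\<delta> - \<epsilon> \<in> A" if "\<forall>\<^sub>F x in F. \<bar>f x - \<delta>\<bar> \<le> \<epsilon>" for \<delta> \<epsilon>
    using that unfolding A_def mem_Collect_eq by eventually_elim linarith
  obtain \<delta>\<^sub>1 where \<delta>\<^sub>1: "\<forall>\<^sub>F x in F. \<bar>f x - \<delta>\<^sub>1\<bar> \<le> 1" using near[of 1] by auto
  have bdd: "bdd_above A" using bound[OF _ \<delta>\<^sub>1] by (rule bdd_aboveI)
  have ne: "A \<noteq> {}" using mem[OF \<delta>\<^sub>1] by blast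
  have Sup_near: "\<bar>Sup A - \<delta>\<bar> \<le> \<epsilon>" if "\<forall>\<^sub>F x in F. \<bar>f x - \<delta>\<bar> \<le> \<epsilon>" for \<delta> \<epsilon>
  proof -
    have "Sup A \<le> \<delta> + \<epsilon>" using ne bound[OF _ that] by (rule cSup_least)
    moreover have "\<delta> - \<epsilon> \<le> Sup A" using mem[OF that] bdd by (rule cSup_upper)
    ultimately show ?thesis by linarith
  qed
  have "(f \<longlongrightarrow> Sup A) F"
  proof (rule tendstoI)
    fix e :: real assume "e > 0"
    then obtain \<delta> where \<delta>: "\<forall>\<^sub>F x in F. \<bar>f x - \<delta>\<bar> \<le> e / 3" using near[of "e / 3"] by auto
    show "\<forall>\<^sub>F x in F. dist (f x) (Sup A) < e"
      using \<delta>
    proof eventually_elim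
      case (elim x)
      then show ?case using Sup_near[OF \<delta>] \<open>e > 0\<close> unfolding dist_real_def by linarith
    qed
  qed
  moreover have "c \<le> Sup A"
  proof (rule field_le_epsilon)
    fix e :: real assume "e > 0"
    then obtain \<delta> where "\<delta> \<ge> c" "\<forall>\<^sub>F x in F. \<bar>f x - \<delta>\<bar> \<le> e" using near by blast
    then show "c \<le> Sup A + e" using Sup_near by fastforce
  qed
  ultimately show ?thesis by blast
qed

section \<open>Locator sets of finite sets of generators\<close>

lemma mem_locator_set:
  "t \<in> locator_set B P Q \<longleftrightarrow>
     (\<forall>p\<in>P. \<forall>b\<in>B. t + p \<notin> sublattice b) \<and> (\<forall>q\<in>Q. \<exists>b\<in>B. t + q \<in> sublattice b)"
  by (auto simp: locator_set_def V_free_def image_subset_iff)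

lemma simultaneous_congruences:
  fixes c :: "nat \<Rightarrow> int ^ 'n"
  assumes "finite K" "pairwise coprime K" "\<forall>b\<in>K. 0 < b"
  obtains t :: "int ^ 'n" where "\<And>b. b \<in> K \<Longrightarrow> t + c b \<in> sublattice b"
proof -
  have "\<exists>x. \<forall>b\<in>K. int b dvd x + c b $ i" for i
  proof -
    obtain x where x: "\<forall>b\<in>K. [x = nat (- c b $ i mod int b)] (mod b)"
      using chinese_remainder_nat[of K "\<lambda>b. b" "\<lambda>b. nat (- c b $ i mod int b)"] assms(1,2)
      by (auto simp: pairwise_def)
    have "int b dvd int x + c b $ i" if "b \<in> K" for b
    proof -
      have "[int x = int (nat (- c b $ i mod int b))] (mod int b)"
        using x that cong_int_iff by blast
      moreover have "0 \<le> - c b $ i mod int b" using that assms(3) by simp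
      ultimately have "[int x = - c b $ i] (mod int b)" by simp
      then show ?thesis by (simp add: cong_iff_dvd_diff)
    qed
    then show ?thesis by blast
  qed
  then obtain x where "\<And>i. \<forall>b\<in>K. int b dvd x i + c b $ i" by metis
  then show ?thesis by (intro that[of "\<chi> i. x i"]) (simp add: mem_sublattice)
qed

text \<open>
  The difference of two points of the intersection is divisible by \<open>N\<close> and by \<open>b\<close>, hence by \<open>N b\<close>.
  If the intersection is empty, any \<open>s\<close> will do.
\<close>

lemma coset_Int_shifted_sublattice:
  assumes "coprime N b"
  shows "\<exists>s. coset N a \<inter> {t. t + x \<in> sublattice b} \<subseteq> coset (N * b) s"
proof (cases "coset N a \<inter> {t. t + x \<in> sublattice b} = {}")
  case False
  then obtain s where s: "s \<in> coset N a" "s + x \<in> sublattice b" by blast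
  have "t \<in> coset (N * b) s" if t: "t \<in> coset N a" "t + x \<in> sublattice b" for t
  proof -
    have "int (N * b) dvd t $ i - s $ i" for i
    proof -
      have "int N dvd (t $ i - a $ i) - (s $ i - a $ i)"
        using s(1) t(1) unfolding coset_def by (blast intro: dvd_diff)
      moreover have "int b dvd (t + x) $ i - (s + x) $ i"
        using s(2) t(2) unfolding mem_sublattice by (blast intro: dvd_diff)
      ultimately show ?thesis using assms by (simp add: divides_mult)
    qed
    then show ?thesis by (simp add: coset_def)
  qed
  then show ?thesis by blast
qed auto

lemma density_locator_set_finite:
  fixes P Q :: "(int ^ 'n) set"
  assumes "finite K" "\<forall>b\<in>K. 0 < b"
  shows "\<exists>\<delta>. (frequency (locator_set K P Q) \<longlongrightarrow> \<delta>) at_top"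
proof (rule density_periodic)
  show "0 < \<Prod>K" using assms by (intro prod_pos) auto
  fix s t :: "int ^ 'n" assume s: "s \<in> locator_set K P Q" and t: "t \<in> coset (\<Prod>K) s"
  have "t + x \<in> sublattice b \<longleftrightarrow> s + x \<in> sublattice b" if "b \<in> K" for b x
  proof -
    have "int b dvd t $ i - s $ i" for i
    proof -
      have "int b dvd int (\<Prod>K)" using that assms(1) by (simp add: dvd_prodI)
      also have "\<dots> dvd t $ i - s $ i" using t unfolding coset_def by blast
      finally show ?thesis .
    qed
    then have "int b dvd t $ i + x $ i \<longleftrightarrow> int b dvd s $ i + x $ i" for i
      using dvd_add_right_iff[of "int b" "t $ i - s $ i" "s $ i + x $ i"] by simp
    then show ?thesis by (simp add: mem_sublattice)
  qed
  then show "t \<in> locator_set K P Q" using s by (simp add: mem_locator_set)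
qed

text \<open>
  Here \<open>c b\<close> represents a coset modulo \<open>b\<close> that avoids \<open>P\<close>, and every \<open>q \<in> Q\<close> is one of these
  representatives.  Therefore the single congruence \<open>t \<equiv> -c b\<close> modulo \<open>b\<close> for each \<open>b \<in> K0\<close> keeps \<open>t + P\<close> away from
  \<open>b\<int>\<^sup>d\<close> and at the same time moves every \<open>t + q\<close> into some \<open>b\<int>\<^sup>d\<close>.  The \<open>t\<close> with these congruences form a coset
  modulo \<open>N = \<Prod>K0\<close>.  Removing from it the exceptions caused by \<open>b \<in> K - K0\<close> costs at most the
  proportion \<open>|P| \<Sum>b\<^sup>-\<^sup>d \<le> 1/2\<close>, so the bound depends on \<open>K0\<close> but not on \<open>K\<close>.
\<close>

lemma density_locator_set_lower_bound:
  fixes P Q :: "(int ^ 'n) set"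
  assumes P: "finite P" and K: "finite K" "K0 \<subseteq> K" "\<forall>b\<in>K. 0 < b" "pairwise coprime K"
    and free: "\<And>p b. p \<in> P \<Longrightarrow> b \<in> K0 \<Longrightarrow> p \<notin> coset b (c b)"
    and hit: "\<And>q. q \<in> Q \<Longrightarrow> \<exists>b\<in>K0. c b = q"
    and small: "real (card P) * (\<Sum>b\<in>K - K0. 1 / real b ^ CARD('n)) \<le> 1 / 2"
    and \<delta>: "(frequency (locator_set K P Q) \<longlongrightarrow> \<delta>) at_top"
  shows "1 / (2 * real (\<Prod>K0) ^ CARD('n)) \<le> \<delta>"
proof -
  let ?d = "CARD('n)"
  define N where "N = \<Prod>K0"
  have K0: "finite K0" "\<forall>b\<in>K0. 0 < b" "pairwise coprime K0"
    using K by (auto intro: finite_subset pairwise_subset)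
  have "N > 0" unfolding N_def using K0 by (intro prod_pos) auto
  obtain t0 where t0: "\<And>b. b \<in> K0 \<Longrightarrow> t0 + c b \<in> sublattice b"
    using simultaneous_congruences[OF K0(1,3,2)] by metis
  have base: "t + c b \<in> sublattice b" if "t \<in> coset N t0" "b \<in> K0" for t b
  proof -
    have "int b dvd t $ i + c b $ i" for i
    proof -
      have "int b dvd int N" using that K0(1) by (simp add: N_def dvd_prodI)
      also have "\<dots> dvd t $ i - t0 $ i" using that unfolding coset_def by blast
      finally have "int b dvd (t $ i - t0 $ i) + (t0 + c b) $ i"
        using t0[OF that(2)] unfolding mem_sublattice by (blast intro: dvd_add)
      then show ?thesis by simp
    qed
    then show ?thesis by (simp add: mem_sublattice)
  qed
  define s where "s p b = (SOME s. coset N t0 \<inter> {t. t + p \<in> sublattice b} \<subseteq> coset (N * b) s)" for p b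
  have s: "coset N t0 \<inter> {t. t + p \<in> sublattice b} \<subseteq> coset (N * b) (s p b)" if "b \<in> K - K0" for p b
    unfolding s_def
  proof (rule someI_ex, rule coset_Int_shifted_sublattice)
    show "coprime N b"
      unfolding N_def using that K(2,4) by (intro prod_coprime_left) (auto simp: pairwise_def)
  qed
  have cover: "coset N t0 \<subseteq> locator_set K P Q \<union> (\<Union>p\<in>P. \<Union>b\<in>K - K0. coset (N * b) (s p b))"
  proof
    fix t assume t: "t \<in> coset N t0"
    show "t \<in> locator_set K P Q \<union> (\<Union>p\<in>P. \<Union>b\<in>K - K0. coset (N * b) (s p b))"
    proof (cases "\<exists>p\<in>P. \<exists>b\<in>K - K0. t + p \<in> sublattice b")
      case True
      then show ?thesis using t s by blast
    next
      case False
      have "t + p \<notin> sublattice b" if "p \<in> P" "b \<in> K" for p b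
      proof (cases "b \<in> K0")
        case True
        show ?thesis
        proof
          assume "t + p \<in> sublattice b"
          then have "int b dvd (t + p) $ i - (t + c b) $ i" for i
            using base[OF t True] unfolding mem_sublattice by (blast intro: dvd_diff)
          then show False using free[OF that(1) True] by (simp add: coset_def)
        qed
      qed (use False that in blast)
      moreover have "\<exists>b\<in>K. t + q \<in> sublattice b" if "q \<in> Q" for q
        using hit[OF that] base[OF t] K(2) by blast
      ultimately show ?thesis by (simp add: mem_locator_set)
    qed
  qed
  have "frequency (coset N t0) r \<le> frequency (locator_set K P Q) r
      + (\<Sum>p\<in>P. \<Sum>b\<in>K - K0. frequency (coset (N * b) (s p b)) r)" for r
  proof -
    have "frequency (coset N t0) r \<le> frequency (locator_set K P Q) r
        + frequency (\<Union>p\<in>P. \<Union>b\<in>K - K0. coset (N * b) (s p b)) r"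
      using frequency_mono[OF cover] frequency_Un_le order_trans by blast
    also have "frequency (\<Union>p\<in>P. \<Union>b\<in>K - K0. coset (N * b) (s p b)) r
        \<le> (\<Sum>p\<in>P. frequency (\<Union>b\<in>K - K0. coset (N * b) (s p b)) r)"
      by (rule frequency_UN_le[OF P])
    also have "\<dots> \<le> (\<Sum>p\<in>P. \<Sum>b\<in>K - K0. frequency (coset (N * b) (s p b)) r)"
      using K(1) by (intro sum_mono frequency_UN_le) auto
    finally show ?thesis by simp
  qed
  moreover have "((\<lambda>r. frequency (locator_set K P Q) r
      + (\<Sum>p\<in>P. \<Sum>b\<in>K - K0. frequency (coset (N * b) (s p b)) r))
      \<longlongrightarrow> \<delta> + (\<Sum>p\<in>P. \<Sum>b\<in>K - K0. 1 / real (N * b) ^ ?d)) at_top"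
    using \<open>N > 0\<close> K(3) by (intro tendsto_add \<delta> tendsto_sum density_coset) auto
  ultimately have "1 / real N ^ ?d \<le> \<delta> + (\<Sum>p\<in>P. \<Sum>b\<in>K - K0. 1 / real (N * b) ^ ?d)"
    by (intro tendsto_le[OF _ _ density_coset[OF \<open>N > 0\<close>, of t0]]) auto
  also have "(\<Sum>p\<in>P. \<Sum>b\<in>K - K0. 1 / real (N * b) ^ ?d)
      = 1 / real N ^ ?d * (real (card P) * (\<Sum>b\<in>K - K0. 1 / real b ^ ?d))"
    by (simp add: power_mult_distrib sum_distrib_left mult.left_commute)
  also have "\<dots> \<le> 1 / real N ^ ?d * (1 / 2)"
    by (intro mult_left_mono small) auto
  finally show ?thesis by (simp add: N_def field_simps)
qed

section \<open>Admissible sets\<close>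

lemma infinite_nat_set_injection:
  fixes B :: "nat set"
  assumes "infinite B" "finite Q"
  obtains f where "inj_on f Q" "\<And>q. q \<in> Q \<Longrightarrow> f q \<in> B \<and> m < f q"
proof -
  have "infinite (B - {..m})" using assms(1) by simp
  then obtain T where T: "finite T" "card T = card Q" "T \<subseteq> B - {..m}"
    using infinite_arbitrarily_large by metis
  obtain f where "bij_betw f Q T" using finite_same_card_bij[OF assms(2) T(1)] T(2) by auto
  then show ?thesis using T(3) by (intro that[of f]) (auto simp: bij_betw_def)
qed

text \<open>
  Distinct \<open>q \<in> Q\<close> get distinct generators, each exceeding the
  absolute values of all coordinates of all \<open>p - q\<close>.  For such a \<open>b\<close>
  a congruence \<open>p \<equiv> q\<close> modulo \<open>b\<close> would mean \<open>p = q\<close>, contrary to the disjointness of \<open>P\<close> and \<open>Q\<close>, so \<open>q\<close>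
  itself represents a coset that \<open>P\<close> misses.  At all other \<open>b\<close> the cosets come from admissibility.
\<close>

lemma missed_cosets_with_prescribed_hits:
  fixes P Q :: "(int ^ 'n) set"
  assumes "infinite B" "finite P" "finite Q" "P \<inter> Q = {}" "admissible B P"
  obtains c K where "finite K" "K \<subseteq> B"
    "\<And>p b. p \<in> P \<Longrightarrow> b \<in> B \<Longrightarrow> p \<notin> coset b (c b)"
    "\<And>q. q \<in> Q \<Longrightarrow> \<exists>b\<in>K. c b = q"
proof -
  define m where "m = nat (\<Sum>p\<in>P. \<Sum>q\<in>Q. \<Sum>i\<in>UNIV. \<bar>p $ i - q $ i\<bar>)"
  have m: "\<bar>p $ i - q $ i\<bar> \<le> int m" if "p \<in> P" "q \<in> Q" for p q i
  proof -
    have "\<bar>p $ i - q $ i\<bar> \<le> (\<Sum>i\<in>UNIV. \<bar>p $ i - q $ i\<bar>)"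
      by (rule member_le_sum) auto
    also have "\<dots> \<le> (\<Sum>q\<in>Q. \<Sum>i\<in>UNIV. \<bar>p $ i - q $ i\<bar>)"
      using assms(3) that by (intro member_le_sum) (auto intro: sum_nonneg)
    also have "\<dots> \<le> (\<Sum>p\<in>P. \<Sum>q\<in>Q. \<Sum>i\<in>UNIV. \<bar>p $ i - q $ i\<bar>)"
      using assms(2) that by (intro member_le_sum[where f = "\<lambda>p. \<Sum>q\<in>Q. \<Sum>i\<in>UNIV. \<bar>p $ i - q $ i\<bar>"])
        (auto intro!: sum_nonneg)
    also have "\<dots> \<le> int m" by (simp add: m_def)
    finally show ?thesis .
  qed
  obtain f where f: "inj_on f Q" "\<And>q. q \<in> Q \<Longrightarrow> f q \<in> B \<and> m < f q"
    using infinite_nat_set_injection[OF assms(1,3)] by metis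
  obtain c0 where c0: "\<And>b. b \<in> B \<Longrightarrow> P \<inter> coset b (c0 b) = {}"
    using assms(5) unfolding admissible_def image_add_sublattice by metis
  define c where "c b = (if b \<in> f ` Q then the_inv_into Q f b else c0 b)" for b
  have cf: "c (f q) = q" if "q \<in> Q" for q
    using that f(1) by (simp add: c_def the_inv_into_f_f)
  show ?thesis
  proof (rule that[of "f ` Q" c])
    fix p b assume p: "p \<in> P" and b: "b \<in> B"
    show "p \<notin> coset b (c b)"
    proof (cases "b \<in> f ` Q")
      case True
      then obtain q where q: "q \<in> Q" "b = f q" by blast
      have "p $ i = q $ i" if "p \<in> coset b q" for i
      proof (rule ccontr)
        assume "p $ i \<noteq> q $ i"
        moreover have "int b dvd p $ i - q $ i" using that by (simp add: coset_def)
        ultimately have "int b \<le> \<bar>p $ i - q $ i\<bar>"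
          using dvd_imp_le_int[of "p $ i - q $ i" "int b"] by simp
        then show False using m[OF p q(1), of i] f(2)[OF q(1)] q(2) by linarith
      qed
      moreover have "p \<noteq> q" using assms(4) p q(1) by blast
      ultimately have "p \<notin> coset b q" unfolding vec_eq_iff by blast
      then show ?thesis using cf[OF q(1)] q(2) by simp
    next
      case False
      then show ?thesis using c0[OF b] p by (auto simp: c_def)
    qed
  next
    fix q assume "q \<in> Q"
    then show "\<exists>b\<in>f ` Q. c b = q" using cf by blast
  qed (use assms(3) f(2) in auto)
qed

text \<open>
  \<open>K0\<close> collects the generators that serve the points of \<open>Q\<close> and enough others to make
  \<open>|P| \<Sum>b\<^sup>-\<^sup>d\<close> over the rest small.  All finite sets \<open>K\<close> with \<open>K0 \<subseteq> K \<subseteq> B\<close> then give densities of at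
  least the same \<open>\<kappa> > 0\<close>, and these densities approximate the frequencies of \<open>locator_set B P Q\<close>.
\<close>

lemma positive_density_if_admissible:
  fixes P Q :: "(int ^ 'n) set"
  assumes Erdos: "Erdos CARD('n) B" and fin: "finite P" "finite Q" and disj: "P \<inter> Q = {}"
    and adm: "admissible B P"
  shows "\<exists>\<delta>>0. (frequency (locator_set B P Q) \<longlongrightarrow> \<delta>) at_top"
proof -
  let ?d = "CARD('n)"
  have B: "infinite B" "\<forall>b\<in>B. 0 < b" "pairwise coprime B"
    and summable: "(\<lambda>b. 1 / real b ^ ?d) summable_on B"
    using Erdos by (auto simp: Erdos_def B_free_generators_def)
  obtain c Kq where Kq: "finite Kq" "Kq \<subseteq> B"
    and free: "\<And>p b. p \<in> P \<Longrightarrow> b \<in> B \<Longrightarrow> p \<notin> coset b (c b)"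
    and hit: "\<And>q. q \<in> Q \<Longrightarrow> \<exists>b\<in>Kq. c b = q"
    using missed_cosets_with_prescribed_hits[OF B(1) fin disj adm] by metis
  have "1 / (2 * (real (card P) + 1)) > 0" by (simp add: add_nonneg_pos)
  from summable_on_small_tail[OF summable this] obtain K1
    where K1: "finite K1" "K1 \<subseteq> B"
      and tail: "\<And>F. finite F \<Longrightarrow> F \<subseteq> B - K1 \<Longrightarrow>
        (\<Sum>b\<in>F. 1 / real b ^ ?d) < 1 / (2 * (real (card P) + 1))" by blast
  define K0 where "K0 = Kq \<union> K1"
  have K0: "finite K0" "K0 \<subseteq> B" using Kq K1 by (auto simp: K0_def)
  define \<kappa> where "\<kappa> = 1 / (2 * real (\<Prod>K0) ^ ?d)"
  have "0 < \<Prod>K0" using K0 B(2) by (intro prod_pos) auto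
  then have "\<kappa> > 0" unfolding \<kappa>_def by (simp del: of_nat_prod)
  have lower: "\<kappa> \<le> \<delta>" if K: "finite K" "K0 \<subseteq> K" "K \<subseteq> B"
    and \<delta>: "(frequency (locator_set K P Q) \<longlongrightarrow> \<delta>) at_top" for K \<delta>
    unfolding \<kappa>_def
  proof (rule density_locator_set_lower_bound[where c = c, OF fin(1) K(1,2) _ _ _ _ _ \<delta>])
    show "\<forall>b\<in>K. 0 < b" "pairwise coprime K" using B K(3) by (auto intro: pairwise_subset)
    show "p \<notin> coset b (c b)" if "p \<in> P" "b \<in> K0" for p b using free that K0 by blast
    show "\<exists>b\<in>K0. c b = q" if "q \<in> Q" for q using hit[OF that] by (auto simp: K0_def)
    have "(\<Sum>b\<in>K - K0. 1 / real b ^ ?d) < 1 / (2 * (real (card P) + 1))"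
      using K by (intro tail) (auto simp: K0_def)
    then have "real (card P) * (\<Sum>b\<in>K - K0. 1 / real b ^ ?d) \<le> real (card P) * (1 / (2 * (real (card P) + 1)))"
      by (intro mult_left_mono) auto
    also have "\<dots> \<le> 1 / 2" by (simp add: field_simps)
    finally show "real (card P) * (\<Sum>b\<in>K - K0. 1 / real b ^ ?d) \<le> 1 / 2" .
  qed
  have "\<exists>\<delta>\<ge>\<kappa>. (frequency (locator_set B P Q) \<longlongrightarrow> \<delta>) at_top"
  proof (rule tendsto_if_eventually_near_constants)
    fix \<epsilon> :: real assume "\<epsilon> > 0"
    then obtain K2 where K2: "finite K2" "K2 \<subseteq> B"
      and rare: "\<forall>\<^sub>F r in at_top. frequency {t. \<exists>x\<in>P \<union> Q. \<exists>b\<in>B - K2. t + x \<in> sublattice b} r \<le> \<epsilon> / 2"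
      using frequency_tail_small[OF B(2) summable, of "P \<union> Q" "\<epsilon> / 2"] fin by auto
    define K where "K = K0 \<union> K2"
    have K: "finite K" "K0 \<subseteq> K" "K \<subseteq> B" using K0 K2 by (auto simp: K_def)
    define E where "E = {t. \<exists>x\<in>P \<union> Q. \<exists>b\<in>B - K2. t + x \<in> sublattice b}"
    obtain \<delta> where \<delta>: "(frequency (locator_set K P Q) \<longlongrightarrow> \<delta>) at_top"
      using density_locator_set_finite[OF K(1)] B(2) K(3) by blast
    have agree: "t \<in> locator_set B P Q \<longleftrightarrow> t \<in> locator_set K P Q" if "t \<notin> E" for t
    proof -
      have "(\<exists>b\<in>B. t + x \<in> sublattice b) \<longleftrightarrow> (\<exists>b\<in>K. t + x \<in> sublattice b)" if "x \<in> P \<union> Q" for x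
        using \<open>t \<notin> E\<close> that K(3) unfolding E_def K_def by blast
      then show ?thesis unfolding mem_locator_set by blast
    qed
    have near: "\<bar>frequency (locator_set B P Q) r - frequency (locator_set K P Q) r\<bar> \<le> frequency E r" for r
    proof -
      have "locator_set B P Q \<subseteq> locator_set K P Q \<union> E" "locator_set K P Q \<subseteq> locator_set B P Q \<union> E"
        using agree by blast+
      from this[THEN frequency_mono, of r] show ?thesis
        using frequency_Un_le[of "locator_set K P Q" E r] frequency_Un_le[of "locator_set B P Q" E r]
        by linarith
    qed
    have "\<forall>\<^sub>F r in at_top. dist (frequency (locator_set K P Q) r) \<delta> < \<epsilon> / 2"
      using \<delta> \<open>\<epsilon> > 0\<close> by (intro tendstoD) auto
    with rare have "\<forall>\<^sub>F r in at_top. \<bar>frequency (locator_set B P Q) r - \<delta>\<bar> \<le> \<epsilon>"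
    proof eventually_elim
      case (elim r)
      then show ?case using near[of r] unfolding E_def dist_real_def by linarith
    qed
    with lower[OF K \<delta>] show "\<exists>\<delta>\<ge>\<kappa>. \<forall>\<^sub>F r in at_top. \<bar>frequency (locator_set B P Q) r - \<delta>\<bar> \<le> \<epsilon>"
      by blast
  qed simp
  then show ?thesis using \<open>\<kappa> > 0\<close> by (meson less_le_trans)
qed

lemma admissible_if_locator_set_nonempty:
  assumes "locator_set B P Q \<noteq> {}"
  shows "admissible B P"
proof -
  obtain t where t: "t \<in> locator_set B P Q" using assms by blast
  have "P \<inter> coset b (- t) = {}" if "b \<in> B" for b
    using t that by (force simp: mem_locator_set coset_def mem_sublattice add.commute)
  then show ?thesis unfolding admissible_def image_add_sublattice by blast
qed

theorem proposition4p4: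
  fixes B :: "nat set" and P Q :: "(int ^ 'n) set"
  assumes "Erdos CARD('n) B"
    and "finite P" and "finite Q" and "P \<inter> Q = {}"
  shows "(has_positive_natural_density (lattice_embedding ` locator_set B P Q)
            \<longleftrightarrow> locator_set B P Q \<noteq> {}) \<and>
         (locator_set B P Q \<noteq> {} \<longleftrightarrow> admissible B P)"
proof -
  have dense: "has_positive_natural_density (lattice_embedding ` locator_set B P Q)" if "admissible B P"
    using positive_density_if_admissible[OF assms that]
    by (auto simp: has_positive_natural_density_def has_natural_density_iff_frequency)
  have nonempty: "locator_set B P Q \<noteq> {}"
    if pos: "has_positive_natural_density (lattice_embedding ` locator_set B P Q)"
  proof
    assume empty: "locator_set B P Q = {}"
    obtain \<delta> where \<delta>: "\<delta> > 0" "has_natural_density (lattice_embedding ` locator_set B P Q) \<delta>"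
      using pos unfolding has_positive_natural_density_def by blast
    from \<delta>(2) have "(frequency ({} :: (int ^ 'n) set) \<longlongrightarrow> \<delta>) at_top"
      by (simp only: has_natural_density_iff_frequency empty)
    moreover have "frequency ({} :: (int ^ 'n) set) = (\<lambda>r. 0)"
      by (simp add: fun_eq_iff frequency_def window_def)
    ultimately show False using \<delta>(1) by (simp add: tendsto_const_iff)
  qed
  show ?thesis using dense nonempty admissible_if_locator_set_nonempty by blast
qed

end
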